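(* Let $A$ be a subset of a topological space $X$. Then $e^*\text{-}ker_\theta(A)=\{x\in X : e^*\text{-}cl_\theta(\{x\})\cap A\neq\emptyset\}$.
   Context: No separation axioms are assumed on topological spaces. For a subset $A$ of a topological space $X$, $cl(A)$ and $int(A)$ denote closure and interior, and $\delta\text{-}cl(A)=\{x\in X : int(cl(U))\cap A\neq\emptyset \text{ for every open } U \ni x\}$. $A$ is $e^*$-open if $A\subseteq cl(int(\delta\text{-}cl(A)))$; $e^*$-closed if its complement is $e^*$-open. $e^*\text{-}cl(A)$ is the intersection of all $e^*$-closed sets containing $A$. The $e^*$-$\theta$-closure of $A$ is $e^*\text{-}cl_\theta(A)=\{x\in X : e^*\text{-}cl(U)\cap A\neq\emptyset \text{ for every } e^*\text{-open } U\ni x\}$. $A$ is $e^*$-$\theta$-closed if $A=e^*\text{-}cl_\theta(A)$; $e^*$-$\theta$-open if its complement is $e^*$-$\theta$-closed. The $e^*$-$\theta$-kernel of $A$ is $e^*\text{-}ker_\theta(A)=\bigcap\{U : U \text{ is } e^*\text{-}\theta\text{-open in } X \text{ and } A\subseteq U\}$. *)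

theory Defs
  imports "HOL-Analysis.Abstract_Topology"
begin

text \<open>All set operators are relative to an arbitrary space \<open>X\<close> and are intended for subsets of
  \<open>topspace X\<close>; complements are taken in \<open>topspace X\<close>.\<close>

definition delta_closure :: "'a topology \<Rightarrow> 'a set \<Rightarrow> 'a set" where
  "delta_closure X A =
     {x \<in> topspace X. \<forall>U. openin X U \<and> x \<in> U \<longrightarrow> X interior_of (X closure_of U) \<inter> A \<noteq> {}}"

definition estar_open :: "'a topology \<Rightarrow> 'a set \<Rightarrow> bool" where
  "estar_open X A \<longleftrightarrow>
     A \<subseteq> topspace X \<and> A \<subseteq> X closure_of (X interior_of (delta_closure X A))"

definition estar_closed :: "'a topology \<Rightarrow> 'a set \<Rightarrow> bool" where
  "estar_closed X A \<longleftrightarrow> A \<subseteq> topspace X \<and> estar_open X (topspace X - A)"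

definition estar_closure :: "'a topology \<Rightarrow> 'a set \<Rightarrow> 'a set" where
  "estar_closure X A = \<Inter>{F. estar_closed X F \<and> A \<subseteq> F}"

definition estar_theta_closure :: "'a topology \<Rightarrow> 'a set \<Rightarrow> 'a set" where
  "estar_theta_closure X A =
     {x \<in> topspace X. \<forall>U. estar_open X U \<and> x \<in> U \<longrightarrow> estar_closure X U \<inter> A \<noteq> {}}"

definition estar_theta_closed :: "'a topology \<Rightarrow> 'a set \<Rightarrow> bool" where
  "estar_theta_closed X A \<longleftrightarrow> A = estar_theta_closure X A"

definition estar_theta_open :: "'a topology \<Rightarrow> 'a set \<Rightarrow> bool" where
  "estar_theta_open X A \<longleftrightarrow> A \<subseteq> topspace X \<and> estar_theta_closed X (topspace X - A)"

definition estar_theta_kernel :: "'a topology \<Rightarrow> 'a set \<Rightarrow> 'a set" where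
  "estar_theta_kernel X A = \<Inter>{U. estar_theta_open X U \<and> A \<subseteq> U}"

end

theory Submission
  imports Defs
begin

text \<open>
  A point \<open>x\<close> lies outside the kernel of \<open>A\<close> iff some \<open>e\<^sup>*\<close>-\<open>\<theta>\<close>-closed set contains \<open>x\<close> and misses
  \<open>A\<close>. As the \<open>e\<^sup>*\<close>-\<open>\<theta>\<close>-closure is monotone, every \<open>e\<^sup>*\<close>-\<open>\<theta>\<close>-closed set containing \<open>x\<close> includes the
  \<open>e\<^sup>*\<close>-\<open>\<theta>\<close>-closure of \<open>{x}\<close>. So the theorem holds as soon as that closure is itself
  \<open>e\<^sup>*\<close>-\<open>\<theta>\<close>-closed, that is, as soon as the operator is idempotent
  (\<open>estar_theta_closure_idem\<close>).

  A closure operator of \<open>\<theta>\<close> type is not idempotent in general. Here it is, because the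
  \<open>e\<^sup>*\<close>-closure of an \<open>e\<^sup>*\<close>-open set is again \<open>e\<^sup>*\<close>-open (\<open>estar_open_estar_closure\<close>): the sets
  that test for membership are then both \<open>e\<^sup>*\<close>-open and \<open>e\<^sup>*\<close>-closed, so each of them is a test set
  for all of its points at once. This in turn comes from an explicit formula: the largest \<open>e\<^sup>*\<close>-open subset of \<open>B\<close>
  is \<open>B \<inter> cl(int(\<delta>-cl(B)))\<close>. By complementation, the \<open>e\<^sup>*\<close>-closure of a set adds to it only
  points of an open set, and adding an open set preserves \<open>e\<^sup>*\<close>-openness.
\<close>

section \<open>The \<open>e\<^sup>*\<close>-closure of an \<open>e\<^sup>*\<close>-open set\<close>

lemma delta_closure_mono: "A \<subseteq> B \<Longrightarrow> delta_closure X A \<subseteq> delta_closure X B"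
  unfolding delta_closure_def by blast

lemma closure_of_interior_of_delta_closure_mono:
  assumes "A \<subseteq> B"
  shows "X closure_of (X interior_of (delta_closure X A))
           \<subseteq> X closure_of (X interior_of (delta_closure X B))"
  by (intro closure_of_mono interior_of_mono delta_closure_mono assms)

lemma subset_delta_closure:
  assumes "A \<subseteq> topspace X"
  shows "A \<subseteq> delta_closure X A"
proof
  fix x assume x: "x \<in> A"
  have "x \<in> X interior_of (X closure_of U)" if "openin X U" "x \<in> U" for U
  proof -
    have "U \<subseteq> X interior_of (X closure_of U)"
      using closure_of_subset[OF openin_subset[OF that(1)]] that(1) by (rule interior_of_maximal)
    then show ?thesis
      using that(2) by (rule subsetD)
  qed
  then show "x \<in> delta_closure X A"
    using x assms unfolding delta_closure_def by blast
qed

lemma openin_imp_estar_open: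
  assumes "openin X U"
  shows "estar_open X U"
proof -
  have sub: "U \<subseteq> topspace X"
    using assms by (rule openin_subset)
  have "U \<subseteq> X interior_of (delta_closure X U)"
    using subset_delta_closure[OF sub] assms by (rule interior_of_maximal)
  also have "\<dots> \<subseteq> X closure_of \<dots>"
    by (simp add: closure_of_subset interior_of_subset_topspace)
  finally show ?thesis
    using sub by (simp add: estar_open_def)
qed

lemma estar_open_Un:
  assumes "estar_open X A" "estar_open X B"
  shows "estar_open X (A \<union> B)"
  using assms closure_of_interior_of_delta_closure_mono[of A "A \<union> B" X]
    closure_of_interior_of_delta_closure_mono[of B "A \<union> B" X]
  unfolding estar_open_def by blast

text \<open>
  The set \<open>B\<close> is dense, in the \<open>\<delta>\<close> sense, in the open set \<open>W = int(\<delta>-cl(B))\<close>. Density survives the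
  restriction of \<open>B\<close> to \<open>cl(W)\<close>, since a neighbourhood of a point of \<open>W\<close> may be shrunk into \<open>W\<close>.
\<close>

lemma estar_open_Int_closure_of_interior_of_delta_closure:
  assumes "B \<subseteq> topspace X"
  shows "estar_open X (B \<inter> X closure_of (X interior_of (delta_closure X B)))"
proof -
  define W where "W = X interior_of (delta_closure X B)"
  have W: "openin X W" "W \<subseteq> delta_closure X B"
    by (simp_all add: W_def interior_of_subset)
  have "W \<subseteq> delta_closure X (B \<inter> X closure_of W)"
  proof
    fix x assume x: "x \<in> W"
    have "X interior_of (X closure_of N) \<inter> (B \<inter> X closure_of W) \<noteq> {}"
      if N: "openin X N" "x \<in> N" for N
    proof -
      have "openin X (N \<inter> W)" "x \<in> N \<inter> W"
        using N W x by auto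
      moreover have "x \<in> delta_closure X B"
        using W x by blast
      ultimately obtain y where y: "y \<in> X interior_of (X closure_of (N \<inter> W))" "y \<in> B"
        unfolding delta_closure_def by blast
      have "y \<in> X interior_of (X closure_of N)"
        using y(1) interior_of_mono[OF closure_of_mono[of "N \<inter> W" N X]] by blast
      moreover have "y \<in> X closure_of W"
        using y(1) interior_of_subset closure_of_mono[of "N \<inter> W" W X] by fastforce
      ultimately show ?thesis
        using y(2) by blast
    qed
    then show "x \<in> delta_closure X (B \<inter> X closure_of W)"
      using W(1) x openin_subset unfolding delta_closure_def by fastforce
  qed
  then have "W \<subseteq> X interior_of (delta_closure X (B \<inter> X closure_of W))"
    using W(1) by (rule interior_of_maximal)
  then have "X closure_of W
      \<subseteq> X closure_of (X interior_of (delta_closure X (B \<inter> X closure_of W)))"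
    by (rule closure_of_mono)
  then show ?thesis
    using assms unfolding estar_open_def W_def by blast
qed

lemma estar_closure_eq:
  assumes "A \<subseteq> topspace X"
  shows "estar_closure X A =
    A \<union> (topspace X - X closure_of (X interior_of (delta_closure X (topspace X - A))))"
    (is "_ = A \<union> (topspace X - ?C)")
proof
  have "topspace X - (A \<union> (topspace X - ?C)) = (topspace X - A) \<inter> ?C"
    by auto
  then have "estar_closed X (A \<union> (topspace X - ?C))"
    using assms estar_open_Int_closure_of_interior_of_delta_closure[of "topspace X - A" X]
    unfolding estar_closed_def by auto
  then show "estar_closure X A \<subseteq> A \<union> (topspace X - ?C)"
    unfolding estar_closure_def by blast
next
  have "topspace X - ?C \<subseteq> F" if F: "estar_closed X F" "A \<subseteq> F" for F
    using F closure_of_interior_of_delta_closure_mono[of "topspace X - F" "topspace X - A" X]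
    unfolding estar_closed_def estar_open_def by blast
  then show "A \<union> (topspace X - ?C) \<subseteq> estar_closure X A"
    unfolding estar_closure_def by blast
qed

lemma estar_open_estar_closure:
  assumes "estar_open X U"
  shows "estar_open X (estar_closure X U)"
proof -
  have "U \<subseteq> topspace X"
    using assms by (simp add: estar_open_def)
  then show ?thesis
    unfolding estar_closure_eq[OF \<open>U \<subseteq> topspace X\<close>]
    by (intro estar_open_Un assms openin_imp_estar_open openin_diff openin_topspace
        closedin_closure_of)
qed

lemma subset_estar_closure: "A \<subseteq> estar_closure X A"
  unfolding estar_closure_def by blast

lemma estar_closure_idem: "estar_closure X (estar_closure X A) = estar_closure X A"
  unfolding estar_closure_def by blast

section \<open>The \<open>e\<^sup>*\<close>-\<open>\<theta>\<close>-closure as a closure operator\<close>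

lemma estar_theta_closure_subset_topspace: "estar_theta_closure X A \<subseteq> topspace X"
  unfolding estar_theta_closure_def by blast

lemma estar_theta_closure_mono:
  "A \<subseteq> B \<Longrightarrow> estar_theta_closure X A \<subseteq> estar_theta_closure X B"
  unfolding estar_theta_closure_def by blast

lemma subset_estar_theta_closure:
  "A \<subseteq> topspace X \<Longrightarrow> A \<subseteq> estar_theta_closure X A"
  using subset_estar_closure unfolding estar_theta_closure_def by fastforce

text \<open>
  If \<open>V\<close> is the \<open>e\<^sup>*\<close>-closure of an \<open>e\<^sup>*\<close>-open set, then \<open>V\<close> is an \<open>e\<^sup>*\<close>-open neighbourhood of each of its
  points and is its own \<open>e\<^sup>*\<close>-closure. Hence if \<open>V\<close> meets the \<open>e\<^sup>*\<close>-\<open>\<theta>\<close>-closure of \<open>A\<close>, it meets \<open>A\<close>.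
\<close>

lemma estar_theta_closure_idem:
  "estar_theta_closure X (estar_theta_closure X A) = estar_theta_closure X A"
proof
  show "estar_theta_closure X (estar_theta_closure X A) \<subseteq> estar_theta_closure X A"
  proof
    fix x assume x: "x \<in> estar_theta_closure X (estar_theta_closure X A)"
    have "estar_closure X U \<inter> A \<noteq> {}" if U: "estar_open X U" "x \<in> U" for U
    proof -
      obtain z where z: "z \<in> estar_closure X U" "z \<in> estar_theta_closure X A"
        using x U unfolding estar_theta_closure_def[of X "estar_theta_closure X A"] by blast
      then have "estar_closure X (estar_closure X U) \<inter> A \<noteq> {}"
        using estar_open_estar_closure[OF U(1)] unfolding estar_theta_closure_def by blast
      then show ?thesis
        by (simp add: estar_closure_idem)
    qed
    then show "x \<in> estar_theta_closure X A"
      using x unfolding estar_theta_closure_def by blast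
  qed
next
  show "estar_theta_closure X A \<subseteq> estar_theta_closure X (estar_theta_closure X A)"
    by (rule subset_estar_theta_closure[OF estar_theta_closure_subset_topspace])
qed

lemma estar_theta_open_Diff_estar_theta_closure:
  "estar_theta_open X (topspace X - estar_theta_closure X A)"
  using estar_theta_closure_subset_topspace[of X A]
  by (simp add: estar_theta_open_def estar_theta_closed_def double_diff estar_theta_closure_idem)

lemma estar_theta_open_topspace: "estar_theta_open X (topspace X)"
proof -
  have "estar_theta_closure X {} = {}"
    using openin_imp_estar_open[OF openin_topspace] unfolding estar_theta_closure_def by auto
  then show ?thesis
    by (simp add: estar_theta_open_def estar_theta_closed_def)
qed

section \<open>The \<open>e\<^sup>*\<close>-\<open>\<theta>\<close>-kernel\<close>

theorem theorem5p7:
  fixes X :: "'a topology" and A :: "'a set"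
  assumes "A \<subseteq> topspace X"
  shows "estar_theta_kernel X A = {x \<in> topspace X. estar_theta_closure X {x} \<inter> A \<noteq> {}}"
proof (intro equalityI subsetI)
  fix x assume x: "x \<in> estar_theta_kernel X A"
  have top: "x \<in> topspace X"
    using x assms estar_theta_open_topspace unfolding estar_theta_kernel_def by blast
  moreover have "estar_theta_closure X {x} \<inter> A \<noteq> {}"
  proof
    assume "estar_theta_closure X {x} \<inter> A = {}"
    then have "A \<subseteq> topspace X - estar_theta_closure X {x}"
      using assms by blast
    then have "x \<in> topspace X - estar_theta_closure X {x}"
      using x estar_theta_open_Diff_estar_theta_closure unfolding estar_theta_kernel_def by blast
    then show False
      using subset_estar_theta_closure[of "{x}" X] top by blast
  qed
  ultimately show "x \<in> {x \<in> topspace X. estar_theta_closure X {x} \<inter> A \<noteq> {}}"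
    by blast
next
  fix x assume "x \<in> {x \<in> topspace X. estar_theta_closure X {x} \<inter> A \<noteq> {}}"
  then obtain y where top: "x \<in> topspace X" and y: "y \<in> estar_theta_closure X {x}" "y \<in> A"
    by blast
  have "x \<in> U" if U: "estar_theta_open X U" "A \<subseteq> U" for U
  proof (rule ccontr)
    assume "x \<notin> U"
    then have "estar_theta_closure X {x} \<subseteq> estar_theta_closure X (topspace X - U)"
      using top by (intro estar_theta_closure_mono) blast
    also have "\<dots> = topspace X - U"
      using U(1) by (simp add: estar_theta_open_def estar_theta_closed_def)
    finally show False
      using y U(2) by blast
  qed
  then show "x \<in> estar_theta_kernel X A"
    unfolding estar_theta_kernel_def by blast
qed

end
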